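(* Let $G$ be a finite simple graph on the vertex set $[n]$ without isolated vertices, let $K$ be a field and $S=K[x_1,\dots,x_n]$. Then $$J_c(G)\ =\ I(G^c)+K_3(G).$$
   Context: $[n]=\{1,\dots,n\}$; $G$ has vertex set $[n]$ and edge set $E(G)$. For $F\subset[n]$, $P_F=(x_i : i\in F)\subset S$ (with $P_\emptyset=(0)$). The complementary edge ideal of $G$ is $I_c(G)=\big((x_1\cdots x_n)/(x_ix_j) : \{i,j\}\in E(G)\big)$, and the complementary cover ideal of $G$ is its Alexander dual $J_c(G)=I_c(G)^\vee=\bigcap_{\{i,j\}\in E(G)}P_{[n]\setminus\{i,j\}}$. $G^c$ is the complementary graph (same vertex set, edges exactly the pairs $\{i,j\}$, $i\ne j$, not in $E(G)$). The edge ideal of a graph $H$ on $[n]$ is $I(H)=(x_ix_j : \{i,j\}\in E(H))$. The 3-clique ideal is $K_3(G)=(x_ix_jx_k : \{i,j,k\} \text{ is a set of three pairwise adjacent vertices of } G)$. *)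

theory Defs
  imports Complex_Main "HOL-Library.Poly_Mapping" "HOL-Library.Set_Algebras"
begin

section \<open>Polynomial rings and ideals\<close>

text \<open>
  The variables, which are also the vertices of the graphs below, are the elements of a
  finite type \<open>'v\<close>, in the role of \<open>[n]\<close> with \<open>n = CARD('v)\<close>. A polynomial is a finitely
  supported map from exponent vectors to coefficients, multiplied by convolution.
\<close>

type_synonym ('v, 'k) mpoly = "('v \<Rightarrow>\<^sub>0 nat) \<Rightarrow>\<^sub>0 'k"

definition var :: "'v::finite \<Rightarrow> ('v, 'k::field) mpoly" where
  "var i = Poly_Mapping.single (Poly_Mapping.single i 1) 1"

definition sqfree_monom :: "'v::finite set \<Rightarrow> ('v, 'k::field) mpoly" where
  "sqfree_monom F = (\<Prod>i\<in>F. var i)"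

text \<open>
  Ideals of a commutative ring are its submodules as a module over itself, so
  \<open>ideal.span B\<close> is the ideal generated by \<open>B\<close>. The sum of two ideals is the sum of sets
  from \<open>HOL-Library.Set_Algebras\<close>.
\<close>

global_interpretation ideal: module "(*) :: 'a::comm_ring_1 \<Rightarrow> 'a \<Rightarrow> 'a"
  by standard (simp_all add: algebra_simps)

definition prime_of :: "'v::finite set \<Rightarrow> ('v, 'k::field) mpoly set" where
  "prime_of F = ideal.span (var ` F)"

text \<open>
  The index sets of the minimal generators of a squarefree monomial ideal, and its
  Alexander dual \<open>\<Inter>\<^sub>F P\<^sub>F\<close> with \<open>F\<close> ranging over them.
\<close>

definition min_gens :: "('v::finite, 'k::field) mpoly set \<Rightarrow> 'v set set" where
  "min_gens I = {F. sqfree_monom F \<in> I \<and> (\<forall>F'. F' \<subset> F \<longrightarrow> sqfree_monom F' \<notin> I)}"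

definition alexander_dual :: "('v::finite, 'k::field) mpoly set \<Rightarrow> ('v, 'k) mpoly set" where
  "alexander_dual I = (\<Inter>F\<in>min_gens I. prime_of F)"


section \<open>Graphs and their ideals\<close>

text \<open>A simple graph with vertex set \<open>UNIV :: 'v set\<close> is given by its edge set.\<close>

definition simple_graph :: "'v::finite set set \<Rightarrow> bool" where
  "simple_graph E \<longleftrightarrow> (\<forall>e\<in>E. card e = 2)"

definition no_isolated_vertices :: "'v::finite set set \<Rightarrow> bool" where
  "no_isolated_vertices E \<longleftrightarrow> (\<forall>v. \<exists>e\<in>E. v \<in> e)"

definition complement_graph :: "'v::finite set set \<Rightarrow> 'v set set" where
  "complement_graph E = {e. card e = 2 \<and> e \<notin> E}"

definition edge_ideal :: "'v::finite set set \<Rightarrow> ('v, 'k::field) mpoly set" where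
  "edge_ideal E = ideal.span (sqfree_monom ` E)"

definition three_cliques :: "'v::finite set set \<Rightarrow> 'v set set" where
  "three_cliques E = {T. card T = 3 \<and> (\<forall>i\<in>T. \<forall>j\<in>T. i \<noteq> j \<longrightarrow> {i, j} \<in> E)}"

definition three_clique_ideal :: "'v::finite set set \<Rightarrow> ('v, 'k::field) mpoly set" where
  "three_clique_ideal E = ideal.span (sqfree_monom ` three_cliques E)"

text \<open>
  For an edge \<open>e = {i, j}\<close>, the quotient \<open>(x\<^sub>1 \<cdots> x\<^sub>n) / (x\<^sub>i x\<^sub>j)\<close> is the squarefree monomial
  with index set \<open>- e\<close>.
\<close>

definition complementary_edge_ideal :: "'v::finite set set \<Rightarrow> ('v, 'k::field) mpoly set" where
  "complementary_edge_ideal E = ideal.span ((\<lambda>e. sqfree_monom (- e)) ` E)"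

definition complementary_cover_ideal :: "'v::finite set set \<Rightarrow> ('v, 'k::field) mpoly set" where
  "complementary_cover_ideal E = alexander_dual (complementary_edge_ideal E)"


section \<open>The complementary cover ideal as an intersection of monomial primes\<close>

lemma sqfree_monom_eq_single:
  fixes F :: "'v::finite set"
  shows "(sqfree_monom F :: ('v, 'k::field) mpoly) =
    Poly_Mapping.single (\<Sum>i\<in>F. Poly_Mapping.single i 1) 1"
proof (induction F rule: finite_induct[OF finite])
  case 1
  then show ?case by (simp add: sqfree_monom_def)
next
  case (2 i F)
  then show ?case by (simp add: sqfree_monom_def var_def mult_single)
qed

lemma lookup_sqfree_exponent:
  fixes F :: "'v::finite set"
  shows "Poly_Mapping.lookup (\<Sum>i\<in>F. Poly_Mapping.single i (1::nat)) v = (if v \<in> F then 1 else 0)"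
  by (simp add: lookup_sum lookup_single when_def)

lemma keys_in_monomial_ideal:
  fixes \<H> :: "'v::finite set set"
  assumes "p \<in> ideal.span (sqfree_monom ` \<H> :: ('v, 'k::field) mpoly set)"
    and "m \<in> Poly_Mapping.keys p"
  shows "\<exists>H\<in>\<H>. \<forall>v\<in>H. Poly_Mapping.lookup m v > 0"
proof -
  define T :: "('v, 'k) mpoly set" where
    "T = {p. \<forall>m\<in>Poly_Mapping.keys p. \<exists>H\<in>\<H>. \<forall>v\<in>H. Poly_Mapping.lookup m v > 0}"
  have "sqfree_monom H \<in> T" if "H \<in> \<H>" for H
    using that unfolding T_def sqfree_monom_eq_single mem_Collect_eq
    by (intro ballI bexI[of _ H]) (simp_all add: lookup_sqfree_exponent del: One_nat_def)
  then have "sqfree_monom ` \<H> \<subseteq> T" by blast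
  moreover have "ideal.subspace T"
  proof (rule ideal.subspaceI)
    show "0 \<in> T" by (simp add: T_def)
    show "p + q \<in> T" if "p \<in> T" "q \<in> T" for p q
      using that keys_add[of p q] unfolding T_def by blast
    show "c * p \<in> T" if "p \<in> T" for c p
    proof -
      have "\<exists>H\<in>\<H>. \<forall>v\<in>H. Poly_Mapping.lookup m v > 0" if "m \<in> Poly_Mapping.keys (c * p)" for m
      proof -
        obtain a b where "m = a + b" "b \<in> Poly_Mapping.keys p"
          using \<open>m \<in> Poly_Mapping.keys (c * p)\<close> keys_mult[of c p] by blast
        with \<open>p \<in> T\<close> show ?thesis unfolding T_def mem_Collect_eq
          by (metis add_gr_0 lookup_add)
      qed
      then show ?thesis by (simp add: T_def)
    qed
  qed
  ultimately have "p \<in> T" using assms(1) ideal.span_minimal by blast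
  with assms(2) show ?thesis by (simp add: T_def)
qed

lemma sqfree_monom_in_monomial_ideal_iff:
  fixes \<H> :: "'v::finite set set"
  shows "(sqfree_monom F :: ('v, 'k::field) mpoly) \<in> ideal.span (sqfree_monom ` \<H>)
    \<longleftrightarrow> (\<exists>H\<in>\<H>. H \<subseteq> F)"
proof
  assume *: "(sqfree_monom F :: ('v, 'k) mpoly) \<in> ideal.span (sqfree_monom ` \<H>)"
  have "(\<Sum>i\<in>F. Poly_Mapping.single i 1) \<in> Poly_Mapping.keys (sqfree_monom F :: ('v, 'k) mpoly)"
    by (simp add: sqfree_monom_eq_single)
  from keys_in_monomial_ideal[OF * this] show "\<exists>H\<in>\<H>. H \<subseteq> F"
    unfolding lookup_sqfree_exponent by (metis less_irrefl subsetI)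
next
  assume "\<exists>H\<in>\<H>. H \<subseteq> F"
  then obtain H where "H \<in> \<H>" "H \<subseteq> F" by blast
  have "(sqfree_monom F :: ('v, 'k) mpoly) = sqfree_monom (F - H) * sqfree_monom H"
    unfolding sqfree_monom_def using \<open>H \<subseteq> F\<close> by (simp add: prod.subset_diff)
  then show "(sqfree_monom F :: ('v, 'k) mpoly) \<in> ideal.span (sqfree_monom ` \<H>)"
    using \<open>H \<in> \<H>\<close> by (simp add: ideal.span_scale ideal.span_base)
qed

lemma complementary_cover_ideal_eq:
  fixes E :: "'v::finite set set"
  assumes "simple_graph E"
  shows "(complementary_cover_ideal E :: ('v, 'k::field) mpoly set) = (\<Inter>e\<in>E. prime_of (- e))"
proof -
  let ?I = "complementary_edge_ideal E :: ('v, 'k) mpoly set"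
  have mem: "sqfree_monom F \<in> ?I \<longleftrightarrow> (\<exists>H\<in>uminus ` E. H \<subseteq> F)" for F
    using sqfree_monom_in_monomial_ideal_iff[of F "uminus ` E", where 'k = 'k]
    by (simp add: complementary_edge_ideal_def image_image)
  have incomparable: "e = e'" if "e \<in> E" "e' \<in> E" "- e \<subseteq> - e'" for e e'
    using that assms card_subset_eq[of e e'] card_subset_eq[of e' e]
    by (simp add: simple_graph_def)
  have "min_gens ?I = uminus ` E"
  proof (intro equalityI subsetI)
    fix F assume F: "F \<in> min_gens ?I"
    then obtain H where "H \<in> uminus ` E" "H \<subseteq> F" by (auto simp: min_gens_def mem)
    moreover have "\<not> H \<subset> F" using F \<open>H \<in> uminus ` E\<close> unfolding min_gens_def mem by blast
    ultimately show "F \<in> uminus ` E" by blast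
  next
    fix F assume "F \<in> uminus ` E"
    then show "F \<in> min_gens ?I"
      unfolding min_gens_def mem using incomparable by blast
  qed
  then show ?thesis by (simp add: complementary_cover_ideal_def alexander_dual_def)
qed

end

theory Submission
  imports Defs
begin

text \<open>
  All ideals in the statement are generated by squarefree monomials \<open>x\<^sub>H\<close>, and membership of a
  polynomial in such an ideal is a condition on each of its exponent vectors \<open>m\<close> separately,
  which depends only on the support \<open>A\<close> of \<open>m\<close>: some generator must satisfy \<open>H \<subseteq> A\<close>. The sum of
  two such ideals and the intersection of the primes \<open>P\<^sub>F\<close> are described in the same way
  (\<open>mem_monomial_ideal_iff\<close>, \<open>mem_prime_of_iff\<close>), so that the theorem becomes a statement about a set
  \<open>A\<close> of vertices: \<open>A\<close> is contained in no edge if and only if it contains a non-edge or a triangle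
  (\<open>not_inside_edge_iff\<close>).

  A set with at least three vertices lies in no edge, and any three of its vertices either
  include a non-adjacent pair or form a triangle; a set of two vertices lies in no edge exactly
  if it is a non-edge. A set with at most one vertex contains neither a non-edge nor a
  triangle, and it lies in an edge because there are no isolated vertices.
\<close>

abbreviation exponent_support :: "('v \<Rightarrow>\<^sub>0 nat) \<Rightarrow> 'v set" where
  "exponent_support \<equiv> Poly_Mapping.keys"

text \<open>
  A term \<open>c x\<^sup>m\<close> whose support contains \<open>H\<close> is divisible by \<open>x\<^sub>H\<close>, hence lies in the ideal as soon
  as \<open>x\<^sub>H\<close> does; a polynomial is the sum of its terms. The other direction, that no further
  exponent vectors can occur, is \<open>keys_in_monomial_ideal\<close>.
\<close>

lemma mem_monomial_ideal_iff:
  fixes \<H> :: "'v::finite set set" and p :: "('v, 'k::field) mpoly"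
  shows "p \<in> ideal.span (sqfree_monom ` \<H>) \<longleftrightarrow>
    (\<forall>m\<in>Poly_Mapping.keys p. \<exists>H\<in>\<H>. H \<subseteq> exponent_support m)"
proof
  assume "p \<in> ideal.span (sqfree_monom ` \<H>)"
  from keys_in_monomial_ideal[OF this]
  show "\<forall>m\<in>Poly_Mapping.keys p. \<exists>H\<in>\<H>. H \<subseteq> exponent_support m"
    by (simp add: subset_eq in_keys_iff)
next
  assume supp: "\<forall>m\<in>Poly_Mapping.keys p. \<exists>H\<in>\<H>. H \<subseteq> exponent_support m"
  have "Poly_Mapping.single m (Poly_Mapping.lookup p m) \<in> ideal.span (sqfree_monom ` \<H>)"
    if "m \<in> Poly_Mapping.keys p" for m
  proof -
    from bspec[OF supp that] obtain H where "H \<in> \<H>" "H \<subseteq> exponent_support m" ..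
    let ?h = "\<Sum>i\<in>H. Poly_Mapping.single i (1::nat)"
    have "m = (m - ?h) + ?h"
    proof (rule poly_mapping_eqI)
      fix v
      have "v \<in> H \<Longrightarrow> Poly_Mapping.lookup m v > 0"
        using \<open>H \<subseteq> exponent_support m\<close> by (auto simp: in_keys_iff)
      then show "Poly_Mapping.lookup m v = Poly_Mapping.lookup ((m - ?h) + ?h) v"
        unfolding lookup_add lookup_minus lookup_sqfree_exponent by auto
    qed
    then have m: "(m - ?h) + ?h = m" by (rule sym)
    have "Poly_Mapping.single m (Poly_Mapping.lookup p m) =
        Poly_Mapping.single (m - ?h) (Poly_Mapping.lookup p m) * sqfree_monom H"
      by (simp only: sqfree_monom_eq_single mult_single m mult_1_right)
    moreover have "\<dots> \<in> ideal.span (sqfree_monom ` \<H>)"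
      by (intro ideal.span_scale ideal.span_base imageI \<open>H \<in> \<H>\<close>)
    ultimately show ?thesis by (rule ssubst)
  qed
  then have "(\<Sum>m\<in>Poly_Mapping.keys p. Poly_Mapping.single m (Poly_Mapping.lookup p m))
      \<in> ideal.span (sqfree_monom ` \<H>)"
    by (rule ideal.span_sum)
  moreover have "(\<Sum>m\<in>Poly_Mapping.keys p. Poly_Mapping.single m (Poly_Mapping.lookup p m)) = p"
    by (rule poly_mapping_eqI) (simp add: lookup_sum lookup_single when_def in_keys_iff)
  ultimately show "p \<in> ideal.span (sqfree_monom ` \<H>)" by simp
qed

lemma mem_prime_of_iff:
  fixes p :: "('v::finite, 'k::field) mpoly"
  shows "p \<in> prime_of F \<longleftrightarrow> (\<forall>m\<in>Poly_Mapping.keys p. exponent_support m \<inter> F \<noteq> {})"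
proof -
  have "(prime_of F :: ('v, 'k) mpoly set) = ideal.span (sqfree_monom ` ((\<lambda>i. {i}) ` F))"
    by (simp add: prime_of_def sqfree_monom_def image_image)
  then show ?thesis by (auto simp: mem_monomial_ideal_iff)
qed

text \<open>
  Isolated vertices have to be excluded because of the sets \<open>A\<close> with a single vertex: \<open>{v}\<close>
  contains neither a non-edge nor a triangle, and if \<open>v\<close> is isolated it lies in no edge either.
\<close>

lemma not_inside_edge_iff:
  fixes E :: "'v::finite set set"
  assumes "simple_graph E" and "no_isolated_vertices E"
  shows "(\<forall>e\<in>E. \<not> A \<subseteq> e) \<longleftrightarrow> (\<exists>H\<in>complement_graph E \<union> three_cliques E. H \<subseteq> A)"
proof
  assume outside: "\<forall>e\<in>E. \<not> A \<subseteq> e"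
  \<comment> \<open>Some edge exists, since the vertex type is inhabited; hence the empty set is inside an edge.\<close>
  have "A \<noteq> {}" using outside assms(2) unfolding no_isolated_vertices_def by blast
  then obtain i where "i \<in> A" by blast
  have "A \<noteq> {i}" using outside assms(2) unfolding no_isolated_vertices_def by blast
  then obtain j where "j \<in> A" "j \<noteq> i" using \<open>i \<in> A\<close> by blast
  show "\<exists>H\<in>complement_graph E \<union> three_cliques E. H \<subseteq> A"
  proof (cases "\<exists>u\<in>A. \<exists>v\<in>A. u \<noteq> v \<and> {u, v} \<notin> E")
    case True
    then obtain u v where uv: "u \<in> A" "v \<in> A" "u \<noteq> v" "{u, v} \<notin> E" by blast
    then have "{u, v} \<in> complement_graph E" by (simp add: complement_graph_def)
    with uv show ?thesis by (intro bexI[of _ "{u, v}"]) auto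
  next
    case False
    then have adjacent: "{u, v} \<in> E" if "u \<in> A" "v \<in> A" "u \<noteq> v" for u v
      using that by metis
    then have "\<not> A \<subseteq> {i, j}" using outside \<open>i \<in> A\<close> \<open>j \<in> A\<close> \<open>j \<noteq> i\<close> by simp
    then obtain k where "k \<in> A" "k \<noteq> i" "k \<noteq> j" by blast
    have "{i, j, k} \<in> three_cliques E"
      using adjacent \<open>i \<in> A\<close> \<open>j \<in> A\<close> \<open>k \<in> A\<close> \<open>j \<noteq> i\<close> \<open>k \<noteq> i\<close> \<open>k \<noteq> j\<close>
      by (simp add: three_cliques_def)
    then show ?thesis
      using \<open>i \<in> A\<close> \<open>j \<in> A\<close> \<open>k \<in> A\<close> by (intro bexI[of _ "{i, j, k}"]) auto
  qed
next
  assume "\<exists>H\<in>complement_graph E \<union> three_cliques E. H \<subseteq> A"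
  then obtain H where H: "H \<in> complement_graph E \<union> three_cliques E" "H \<subseteq> A" by blast
  show "\<forall>e\<in>E. \<not> A \<subseteq> e"
  proof (intro ballI notI)
    fix e assume "e \<in> E" "A \<subseteq> e"
    then have "H \<subseteq> e" "card e = 2" using H assms(1) by (auto simp: simple_graph_def)
    from \<open>H \<subseteq> e\<close> have "card H \<le> card e" by (simp add: card_mono)
    with \<open>card e = 2\<close> H have "H \<in> complement_graph E" by (auto simp: three_cliques_def)
    then have "H = e" "H \<notin> E"
      using \<open>H \<subseteq> e\<close> \<open>card e = 2\<close> card_subset_eq[of e H] by (auto simp: complement_graph_def)
    with \<open>e \<in> E\<close> show False by simp
  qed
qed

theorem corollary2p2:
  fixes E :: "'v::finite set set"
  assumes "simple_graph E" and "no_isolated_vertices E"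
  shows "(complementary_cover_ideal E :: ('v, 'k::field) mpoly set) =
    edge_ideal (complement_graph E) + three_clique_ideal E"
proof -
  have "edge_ideal (complement_graph E) + three_clique_ideal E =
      (ideal.span (sqfree_monom ` (complement_graph E \<union> three_cliques E)) :: ('v, 'k) mpoly set)"
    unfolding edge_ideal_def three_clique_ideal_def image_Un ideal.span_Un set_plus_def by blast
  also have "\<dots> = (\<Inter>e\<in>E. prime_of (- e))"
  proof (rule set_eqI)
    fix p :: "('v, 'k) mpoly"
    have "p \<in> ideal.span (sqfree_monom ` (complement_graph E \<union> three_cliques E)) \<longleftrightarrow>
        (\<forall>m\<in>Poly_Mapping.keys p. \<forall>e\<in>E. \<not> exponent_support m \<subseteq> e)"
      unfolding mem_monomial_ideal_iff not_inside_edge_iff[OF assms] ..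
    also have "\<dots> \<longleftrightarrow> p \<in> (\<Inter>e\<in>E. prime_of (- e))"
      unfolding INT_iff mem_prime_of_iff by blast
    finally show "p \<in> ideal.span (sqfree_monom ` (complement_graph E \<union> three_cliques E)) \<longleftrightarrow>
      p \<in> (\<Inter>e\<in>E. prime_of (- e))" .
  qed
  also have "\<dots> = complementary_cover_ideal E"
    by (rule complementary_cover_ideal_eq[OF assms(1), symmetric])
  finally show ?thesis by (rule sym)
qed

end
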